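(* For all $n\geq1$ and $\sigma\in\{231,312\}$, $j_n(\{123,213,\sigma\})=\lceil n/2\rceil$.
   Context: A permutation of a finite set $S$ of positive integers is a word in which each element of $S$ appears exactly once; $\mathfrak{S}_n$ is the set of permutations of $\{1,\dots,n\}$. For a permutation $\pi$ and a letter $x$ of $\pi$, $\rho_\pi(x)$ is the maximal consecutive subword of $\pi$ consisting of the letters immediately to the right of $x$ that are all larger than $x$. $\pi$ is Jacobi if $|\rho_\pi(x)|$ is even for all letters $x$. A permutation $\pi$ avoids a pattern $\sigma$ if no subword of $\pi$ has standardization (relative order) $\sigma$. For a set $\Pi$ of patterns, $j_n(\Pi)$ is the number of Jacobi permutations in $\mathfrak{S}_n$ avoiding every pattern in $\Pi$. *)

theory Defs
  imports Complex_Main "HOL-Library.Sublist" "HOL-Combinatorics.Multiset_Permutations"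
begin

text \<open>Permutations of a finite set are words (lists) of distinct letters, as in
  \<^const>\<open>permutations_of_set\<close>. Patterns are words as well, e.g. \<open>[2,3,1]\<close> for \<open>231\<close>.\<close>

definition rho :: "nat list \<Rightarrow> nat \<Rightarrow> nat list" where
  "rho w x = takeWhile (\<lambda>y. x < y) (tl (dropWhile (\<lambda>y. y \<noteq> x) w))"

definition Jacobi :: "nat list \<Rightarrow> bool" where
  "Jacobi w \<longleftrightarrow> (\<forall>x\<in>set w. even (length (rho w x)))"

text \<open>For a word of distinct letters, the number of letters \<open>\<le> x\<close> is the rank of \<open>x\<close>.\<close>

definition standardization :: "nat list \<Rightarrow> nat list" where
  "standardization w = map (\<lambda>x. card {y \<in> set w. y \<le> x}) w"

text \<open>In pattern containment, subwords need not be consecutive.\<close>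

definition avoids :: "nat list \<Rightarrow> nat list \<Rightarrow> bool" where
  "avoids w p \<longleftrightarrow> \<not> (\<exists>u. subseq u w \<and> standardization u = p)"

definition num_Jacobi_avoiding :: "nat \<Rightarrow> nat list set \<Rightarrow> nat" where
  "num_Jacobi_avoiding n P =
     card {w \<in> permutations_of_set {1..n}. Jacobi w \<and> (\<forall>p\<in>P. avoids w p)}"

end

theory Submission
  imports Defs
begin

text \<open>Avoiding \<open>123\<close>, \<open>213\<close> and \<open>231\<close> means that deleting the letter \<open>1\<close> leaves a decreasing
  word; the only letter \<open>x\<close> with \<open>\<rho>(x)\<close> possibly nonempty is then \<open>1\<close>, and \<open>\<rho>(1)\<close> is everything
  to its right. Avoiding \<open>123\<close>, \<open>213\<close> and \<open>312\<close> means that deleting the first letter \<open>k\<close> leaves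
  a decreasing word; only \<open>\<rho>(k)\<close> can be nonempty, and it consists of the \<open>n - k\<close> letters larger
  than \<open>k\<close>. In both cases the permutations correspond to the even numbers below \<open>n\<close>.\<close>

section \<open>Patterns of length three\<close>

text \<open>Replacing letters by ranks loses no order information: when \<open>x < y\<close>, the
  down-set of \<open>y\<close> gains at least \<open>y\<close> itself. Monotonicity of cardinality
  gives the converse.\<close>

lemma rank_less_iff:
  fixes x y :: nat
  assumes "x \<in> set u" "y \<in> set u"
  shows "card {z \<in> set u. z \<le> x} < card {z \<in> set u. z \<le> y} \<longleftrightarrow> x < y"
proof
  assume "x < y"
  then have "{z \<in> set u. z \<le> x} \<subseteq> {z \<in> set u. z \<le> y}"
    "y \<in> {z \<in> set u. z \<le> y} - {z \<in> set u. z \<le> x}"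
    using assms by auto
  then have "{z \<in> set u. z \<le> x} \<subset> {z \<in> set u. z \<le> y}"
    by blast
  then show "card {z \<in> set u. z \<le> x} < card {z \<in> set u. z \<le> y}"
    by (intro psubset_card_mono) auto
next
  assume less: "card {z \<in> set u. z \<le> x} < card {z \<in> set u. z \<le> y}"
  show "x < y"
  proof (rule ccontr)
    assume "\<not> x < y"
    then have "card {z \<in> set u. z \<le> y} \<le> card {z \<in> set u. z \<le> x}"
      by (intro card_mono) auto
    with less show False by simp
  qed
qed

text \<open>Letters of \<open>[a, b, c]\<close> may coincide, so comparisons in both directions are
  recorded.\<close>

lemma standardization_three_order:
  assumes "standardization [a, b, c] = [i, j, k]"
  shows "(a < b \<longleftrightarrow> i < j) \<and> (a < c \<longleftrightarrow> i < k) \<and> (b < c \<longleftrightarrow> j < k)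
    \<and> (b < a \<longleftrightarrow> j < i) \<and> (c < a \<longleftrightarrow> k < i) \<and> (c < b \<longleftrightarrow> k < j)"
proof -
  have "i = card {z \<in> set [a, b, c]. z \<le> a}" "j = card {z \<in> set [a, b, c]. z \<le> b}"
    "k = card {z \<in> set [a, b, c]. z \<le> c}"
    using assms by (simp_all add: standardization_def)
  then show ?thesis
    by (simp only: rank_less_iff list.set_intros)
qed

text \<open>Keeping \<open>S\<close> tied to its elements only by an equation lets the letters be
  listed in increasing order, whatever their order in the word.\<close>

lemma card_le_three:
  fixes x y z :: nat
  assumes "x < y" "y < z" "S = {x, y, z}"
  shows "card {t \<in> S. t \<le> x} = 1" "card {t \<in> S. t \<le> y} = 2" "card {t \<in> S. t \<le> z} = 3"
proof -
  have "{t \<in> S. t \<le> x} = {x}" "{t \<in> S. t \<le> y} = {x, y}" "{t \<in> S. t \<le> z} = {x, y, z}"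
    using assms by auto
  then show "card {t \<in> S. t \<le> x} = 1" "card {t \<in> S. t \<le> y} = 2" "card {t \<in> S. t \<le> z} = 3"
    using assms by auto
qed

lemma standardization_three_iff:
  "standardization [a, b, c] = [1, 2, 3] \<longleftrightarrow> a < b \<and> b < c"
  "standardization [a, b, c] = [2, 1, 3] \<longleftrightarrow> b < a \<and> a < c"
  "standardization [a, b, c] = [2, 3, 1] \<longleftrightarrow> c < a \<and> a < b"
  "standardization [a, b, c] = [3, 1, 2] \<longleftrightarrow> b < c \<and> c < a"
proof -
  have "standardization [a, b, c] = [1, 2, 3]" if "a < b" "b < c"
  proof -
    have "set [a, b, c] = {a, b, c}" by auto
    then show ?thesis
      unfolding standardization_def list.map by (simp only: card_le_three[OF that])
  qed
  then show "standardization [a, b, c] = [1, 2, 3] \<longleftrightarrow> a < b \<and> b < c"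
    using standardization_three_order[of a b c 1 2 3] by auto
  have "standardization [a, b, c] = [2, 1, 3]" if "b < a" "a < c"
  proof -
    have "set [a, b, c] = {b, a, c}" by auto
    then show ?thesis
      unfolding standardization_def list.map by (simp only: card_le_three[OF that])
  qed
  then show "standardization [a, b, c] = [2, 1, 3] \<longleftrightarrow> b < a \<and> a < c"
    using standardization_three_order[of a b c 2 1 3] by auto
  have "standardization [a, b, c] = [2, 3, 1]" if "c < a" "a < b"
  proof -
    have "set [a, b, c] = {c, a, b}" by auto
    then show ?thesis
      unfolding standardization_def list.map by (simp only: card_le_three[OF that])
  qed
  then show "standardization [a, b, c] = [2, 3, 1] \<longleftrightarrow> c < a \<and> a < b"
    using standardization_three_order[of a b c 2 3 1] by auto
  have "standardization [a, b, c] = [3, 1, 2]" if "b < c" "c < a"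
  proof -
    have "set [a, b, c] = {b, c, a}" by auto
    then show ?thesis
      unfolding standardization_def list.map by (simp only: card_le_three[OF that])
  qed
  then show "standardization [a, b, c] = [3, 1, 2] \<longleftrightarrow> b < c \<and> c < a"
    using standardization_three_order[of a b c 3 1 2] by auto
qed

text \<open>Standardization preserves length, so only three-letter subwords can realize such a
  pattern.\<close>

lemma avoids_three_iff:
  "avoids w [i, j, k] \<longleftrightarrow> (\<forall>a b c. subseq [a, b, c] w \<longrightarrow> standardization [a, b, c] \<noteq> [i, j, k])"
proof -
  have "\<exists>a b c. u = [a, b, c]" if "standardization u = [i, j, k]" for u
  proof -
    have "length (standardization u) = 3" using that by simp
    then have "length u = 3" by (simp add: standardization_def)
    then show ?thesis by (auto simp: numeral_3_eq_3 length_Suc_conv)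
  qed
  then show ?thesis unfolding avoids_def by blast
qed

lemma avoids_iff:
  "avoids w [1, 2, 3] \<longleftrightarrow> (\<forall>a b c. subseq [a, b, c] w \<longrightarrow> \<not> (a < b \<and> b < c))"
  "avoids w [2, 1, 3] \<longleftrightarrow> (\<forall>a b c. subseq [a, b, c] w \<longrightarrow> \<not> (b < a \<and> a < c))"
  "avoids w [2, 3, 1] \<longleftrightarrow> (\<forall>a b c. subseq [a, b, c] w \<longrightarrow> \<not> (c < a \<and> a < b))"
  "avoids w [3, 1, 2] \<longleftrightarrow> (\<forall>a b c. subseq [a, b, c] w \<longrightarrow> \<not> (b < c \<and> c < a))"
  by (simp_all only: avoids_three_iff standardization_three_iff)

section \<open>Decreasing words\<close>

text \<open>A two-letter subword of \<open>x # xs\<close> either starts at the head or lies in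
  \<open>xs\<close>. This puts monotonicity into the same language as pattern avoidance.\<close>

lemma sorted_wrt_iff_subseq: "sorted_wrt P xs \<longleftrightarrow> (\<forall>a b. subseq [a, b] xs \<longrightarrow> P a b)"
proof (induction xs)
  case (Cons x xs)
  have "subseq [a, b] (x # xs) \<longleftrightarrow> a = x \<and> b \<in> set xs \<or> subseq [a, b] xs" for a b
    by (cases "a = x") (auto simp: subseq_singleton_left dest: subseq_Cons')
  then show ?case using Cons.IH by auto
qed simp

lemma subseq_set_subset: "subseq xs ys \<Longrightarrow> set xs \<subseteq> set ys"
  by (auto simp: subseq_conv_nths dest: in_set_nthsD)

lemma subseq_distinct: "subseq xs ys \<Longrightarrow> distinct ys \<Longrightarrow> distinct xs"
  by (auto simp: subseq_conv_nths)

lemma decreasing_if_no_ascent: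
  fixes xs :: "nat list"
  assumes "distinct xs" "\<And>a b. subseq [a, b] xs \<Longrightarrow> \<not> a < b"
  shows "sorted_wrt (>) xs"
proof -
  have "a > b" if "subseq [a, b] xs" for a b
    using subseq_distinct[OF that assms(1)] assms(2)[OF that] by simp
  then show ?thesis by (simp add: sorted_wrt_iff_subseq)
qed

definition desc :: "nat set \<Rightarrow> nat list" where
  "desc S = rev (sorted_list_of_set S)"

lemma desc_props:
  assumes "finite S"
  shows "sorted_wrt (>) (desc S)" "set (desc S) = S" "distinct (desc S)" "length (desc S) = card S"
  using assms by (simp_all add: desc_def sorted_wrt_rev)

text \<open>A decreasing word is determined by its letters; hence in both cases only the placement
  or the choice of one letter remains to be counted.\<close>

lemma decreasing_eq_desc:
  assumes "sorted_wrt (>) xs"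
  shows "xs = desc (set xs)"
proof -
  have "sorted_wrt (<) (rev xs)" using assms by (simp add: sorted_wrt_rev)
  then have "rev xs = sorted_list_of_set (set xs)"
    by (intro strict_sorted_equal) auto
  then show ?thesis unfolding desc_def by (metis rev_rev_ident)
qed

text \<open>The hypothesis makes the displayed \<open>x\<close> the first occurrence, which is where
  \<open>dropWhile\<close> stops.\<close>

lemma rho_split: "x \<notin> set u \<Longrightarrow> rho (u @ x # v) x = takeWhile (\<lambda>y. x < y) v"
proof -
  assume "x \<notin> set u"
  then have "dropWhile (\<lambda>y. y \<noteq> x) (u @ x # v) = x # v"
    by (subst dropWhile_append2) auto
  then show ?thesis by (simp add: rho_def)
qed

lemma takeWhile_greater_eq_Nil:
  fixes x :: nat
  assumes "v \<noteq> [] \<Longrightarrow> hd v < x"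
  shows "takeWhile (\<lambda>y. x < y) v = []"
  using assms by (cases v) auto

section \<open>The pattern 231\<close>

text \<open>With the letter 1, an ascent inside \<open>A\<close> gives 231, one inside
  \<open>B\<close> gives 123, and one from \<open>A\<close> to \<open>B\<close> gives 213.
  Conversely, each of the three patterns has an ascent that does not use its smallest letter, hence
  an ascent among letters above 1.\<close>

lemma avoids_123_213_231_iff:
  assumes "w \<in> permutations_of_set {1..n}" "w = A @ 1 # B"
  shows "(\<forall>p\<in>{[1,2,3], [2,1,3], [2,3,1]}. avoids w p) \<longleftrightarrow> sorted_wrt (>) (A @ B)"
proof
  have dist: "distinct w" and set: "set w = {1..n}"
    using assms(1) by (auto simp: permutations_of_set_def)
  have large: "1 < x" if "x \<in> set A \<union> set B" for x
  proof -
    have "x \<in> set w" "x \<noteq> 1" using that dist assms(2) by auto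
    then show ?thesis using set by auto
  qed
  {
    assume av: "\<forall>p\<in>{[1,2,3], [2,1,3], [2,3,1]}. avoids w p"
    have no: "\<not> (c < a \<and> a < b)" "\<not> (a < b \<and> b < c)" "\<not> (b < a \<and> a < c)"
      if "subseq [a, b, c] w" for a b c
      using av that unfolding ball_simps avoids_iff by blast+
    have "sorted_wrt (>) A"
    proof (rule decreasing_if_no_ascent)
      show "distinct A" using dist assms(2) by simp
      fix a b assume ab: "subseq [a, b] A"
      have "subseq ([a, b] @ [1]) (A @ 1 # B)"
        by (rule list_emb_append_mono[OF ab]) simp
      moreover have "a \<in> set A" using subseq_set_subset[OF ab] by simp
      ultimately show "\<not> a < b" using no(1)[of a b 1] large[of a] assms(2) by auto
    qed
    moreover have "sorted_wrt (>) B"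
    proof (rule decreasing_if_no_ascent)
      show "distinct B" using dist assms(2) by simp
      fix a b assume ab: "subseq [a, b] B"
      then have "subseq ([] @ [1, a, b]) (A @ 1 # B)"
        by (intro list_emb_append_mono) auto
      moreover have "a \<in> set B" using subseq_set_subset[OF ab] by simp
      ultimately show "\<not> a < b" using no(2)[of 1 a b] large[of a] assms(2) by auto
    qed
    moreover have "a > b" if "a \<in> set A" "b \<in> set B" for a b
    proof -
      have "subseq ([a] @ [1, b]) (A @ 1 # B)"
        by (intro list_emb_append_mono) (use that in \<open>auto simp: subseq_singleton_left\<close>)
      moreover have "a \<noteq> b" using dist that assms(2) by auto
      ultimately show ?thesis using no(3)[of a 1 b] large[of a] that assms(2) by auto
    qed
    ultimately show "sorted_wrt (>) (A @ B)" by (simp add: sorted_wrt_append)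
  }
  assume dec: "sorted_wrt (>) (A @ B)"
  have "filter (\<lambda>x. x \<noteq> 1) A = A" "filter (\<lambda>x. x \<noteq> 1) B = B"
    using large by (fastforce simp: filter_id_conv)+
  then have filter: "filter (\<lambda>x. x \<noteq> 1) w = A @ B" using assms(2) by simp
  \<comment> \<open>Filtering out 1 respects subwords, so a pair of letters above 1 in
    \<open>w\<close> is already a subword of \<open>A @ B\<close>.\<close>
  have no_ascent: "\<not> x < y" if "subseq u w" "subseq [x, y] u" "1 < x" "1 < y" for x y u
  proof -
    have "subseq [x, y] w" using that subseq_order.trans by blast
    then have "subseq (filter (\<lambda>x. x \<noteq> 1) [x, y]) (A @ B)"
      by (metis filter subseq_filter)
    then have "subseq [x, y] (A @ B)" using that by simp
    then show ?thesis using dec unfolding sorted_wrt_iff_subseq by fastforce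
  qed
  \<comment> \<open>Positivity forces any letter that is not the smallest of its subword to exceed
    1, as \<open>no_ascent\<close> requires.\<close>
  have pos: "0 < a" "0 < b" "0 < c" if "subseq [a, b, c] w" for a b c
    using subseq_set_subset[OF that] set by auto
  show "\<forall>p\<in>{[1,2,3], [2,1,3], [2,3,1]}. avoids w p"
  proof -
    have "\<not> (a < b \<and> b < c)" "\<not> (b < a \<and> a < c)" "\<not> (c < a \<and> a < b)"
      if s: "subseq [a, b, c] w" for a b c
      using no_ascent[OF s, of b c] no_ascent[OF s, of a c] no_ascent[OF s, of a b] pos[OF s]
      by auto
    then show ?thesis unfolding ball_simps avoids_iff by blast
  qed
qed

text \<open>The letter after any \<open>x\<close> in \<open>A\<close> is smaller, being the next
  letter of \<open>A\<close> or 1; after \<open>x\<close> in \<open>B\<close> comes a smaller letter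
  or nothing.\<close>

lemma Jacobi_one_inserted_iff:
  assumes "w \<in> permutations_of_set {1..n}" "w = A @ 1 # B" "sorted_wrt (>) (A @ B)"
  shows "Jacobi w \<longleftrightarrow> even (length B)"
proof -
  have dist: "distinct w" and set: "set w = {1..n}"
    using assms(1) by (auto simp: permutations_of_set_def)
  have large: "1 < x" if "x \<in> set A \<union> set B" for x
  proof -
    have "x \<in> set w" "x \<noteq> 1" using that dist assms(2) by auto
    then show ?thesis using set by auto
  qed
  have "rho w 1 = takeWhile (\<lambda>y. 1 < y) B"
    unfolding assms(2) by (rule rho_split) (use dist assms(2) in auto)
  also have "\<dots> = B" using large by (simp add: takeWhile_eq_all_conv)
  finally have one: "rho w 1 = B" .
  have "rho w x = []" if x: "x \<in> set A" for x
  proof -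
    obtain u v where A: "A = u @ x # v" using split_list[OF x] by blast
    have "rho w x = rho (u @ x # (v @ 1 # B)) x" using A assms(2) by simp
    also have "\<dots> = takeWhile (\<lambda>y. x < y) (v @ 1 # B)"
      by (rule rho_split) (use dist A assms(2) in auto)
    also have "\<dots> = []"
      by (rule takeWhile_greater_eq_Nil)
        (use assms(3) A large[of x] in \<open>auto simp: hd_append sorted_wrt_append\<close>)
    finally show ?thesis .
  qed
  moreover have "rho w x = []" if x: "x \<in> set B" for x
  proof -
    obtain u v where B: "B = u @ x # v" using split_list[OF x] by blast
    have "rho w x = rho ((A @ 1 # u) @ x # v) x" using B assms(2) by simp
    also have "\<dots> = takeWhile (\<lambda>y. x < y) v"
      by (rule rho_split) (use dist B assms(2) in auto)
    also have "\<dots> = []"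
      by (rule takeWhile_greater_eq_Nil)
        (use assms(3) B in \<open>auto simp: sorted_wrt_append\<close>)
    finally show ?thesis .
  qed
  ultimately show ?thesis using one assms(2) unfolding Jacobi_def by auto
qed

text \<open>The parameter \<open>j\<close> counts the letters to the right of 1, so that it is the
  length of \<open>rho\<close> at 1; the other \<open>n - 1 - j\<close> letters stand to the
  left.\<close>

definition insert_one :: "nat \<Rightarrow> nat \<Rightarrow> nat list" where
  "insert_one n j = take (n - 1 - j) (desc {2..n}) @ 1 # drop (n - 1 - j) (desc {2..n})"

lemma Jacobi_avoiding_123_213_231:
  assumes "n \<ge> 1"
  shows "{w \<in> permutations_of_set {1..n}. Jacobi w \<and> (\<forall>p\<in>{[1,2,3], [2,1,3], [2,3,1]}. avoids w p)}
    = insert_one n ` {j. j < n \<and> even j}" (is "?L = ?R")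
proof
  show "?L \<subseteq> ?R"
  proof
    fix w assume w: "w \<in> ?L"
    then have perm: "w \<in> permutations_of_set {1..n}" by simp
    then have dist: "distinct w" and set: "set w = {1..n}"
      by (auto simp: permutations_of_set_def)
    have "1 \<in> set w" using set assms by simp
    then obtain A B where AB: "w = A @ 1 # B" using split_list by fast
    have dec: "sorted_wrt (>) (A @ B)"
      using w avoids_123_213_231_iff[OF perm AB] by blast
    have even: "even (length B)"
      using w Jacobi_one_inserted_iff[OF perm AB dec] by blast
    have "set (A @ B) = set w - {1}" using dist AB by auto
    also have "\<dots> = {2..n}" unfolding set by (rule set_eqI) auto
    finally have D: "A @ B = desc {2..n}" using decreasing_eq_desc[OF dec] by metis
    then have "length (A @ B) = n - 1" using desc_props(4)[of "{2..n}"] by simp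
    \<comment> \<open>Here \<open>n \<ge> 1\<close> turns the truncated \<open>n - 1\<close> into a
      true difference and makes \<open>length B\<close> strictly smaller than
      \<open>n\<close>.\<close>
    then have "n - 1 - length B = length A" "length B < n" using assms by auto
    then have "w = insert_one n (length B)" "length B < n"
      unfolding insert_one_def D[symmetric] AB by simp_all
    then show "w \<in> ?R" using even by blast
  qed
  show "?R \<subseteq> ?L"
  proof
    fix w assume "w \<in> ?R"
    then obtain j where j: "j < n" "even j" and w: "w = insert_one n j" by blast
    define A where "A = take (n - 1 - j) (desc {2..n})"
    define B where "B = drop (n - 1 - j) (desc {2..n})"
    have AB: "w = A @ 1 # B" by (simp add: w insert_one_def A_def B_def)
    have D: "A @ B = desc {2..n}" by (simp add: A_def B_def)
    have set: "set A \<union> set B = {2..n}" and dist: "distinct (A @ B)"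
      using desc_props(2,3)[of "{2..n}"] D by (auto simp flip: set_append)
    have dec: "sorted_wrt (>) (A @ B)" using desc_props(1) D by simp
    have "1 \<notin> set A \<union> set B" "insert 1 (set A \<union> set B) = {1..n}"
      unfolding set using assms by auto
    then have perm: "w \<in> permutations_of_set {1..n}"
      unfolding permutations_of_set_def AB using dist by auto
    have "length B = j" using j(1) desc_props(4)[of "{2..n}"] by (simp add: B_def)
    then show "w \<in> ?L"
      using perm Jacobi_one_inserted_iff[OF perm AB dec] avoids_123_213_231_iff[OF perm AB] dec j(2)
      by blast
  qed
qed

text \<open>Since 1 does not occur in \<open>desc {2..n}\<close>, the part of the word before 1 can
  be read off, and its length \<open>n - 1 - j\<close> determines \<open>j\<close>.\<close>

lemma inj_on_insert_one: "inj_on (insert_one n) {j. j < n \<and> even j}"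
proof (rule inj_onI)
  fix i j assume ij: "i \<in> {j. j < n \<and> even j}" "j \<in> {j. j < n \<and> even j}"
    and eq: "insert_one n i = insert_one n j"
  have takeWhile: "takeWhile (\<lambda>x. x \<noteq> 1) (insert_one n k) = take (n - 1 - k) (desc {2..n})" for k
  proof -
    have "x \<noteq> 1" if "x \<in> set (take (n - 1 - k) (desc {2..n}))" for x
      using in_set_takeD[OF that] desc_props(2)[of "{2..n}"] by auto
    then show ?thesis unfolding insert_one_def by (subst takeWhile_append2) auto
  qed
  have "length (take (n - 1 - i) (desc {2..n})) = length (take (n - 1 - j) (desc {2..n}))"
    using takeWhile eq by metis
  then show "i = j" using ij desc_props(4)[of "{2..n}"] by auto
qed

section \<open>The pattern 312\<close>

text \<open>An ascent \<open>a < b\<close> in \<open>B\<close> forms with \<open>k\<close> the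
  pattern 123, 213 or 312, according to whether \<open>k\<close> lies below, between or above these
  letters. Conversely, all three patterns end in an ascent, and the last two letters of a
  three-letter subword of \<open>w\<close> lie in \<open>B\<close>.\<close>

lemma avoids_123_213_312_iff:
  assumes "distinct w" "w = k # B"
  shows "(\<forall>p\<in>{[1,2,3], [2,1,3], [3,1,2]}. avoids w p) \<longleftrightarrow> sorted_wrt (>) B"
proof
  assume av: "\<forall>p\<in>{[1,2,3], [2,1,3], [3,1,2]}. avoids w p"
  show "sorted_wrt (>) B"
  proof (rule decreasing_if_no_ascent)
    show "distinct B" using assms by simp
    fix a b assume ab: "subseq [a, b] B"
    then have "subseq [k, a, b] w" using assms(2) by simp
    then have "\<not> (k < a \<and> a < b)" "\<not> (a < k \<and> k < b)" "\<not> (a < b \<and> b < k)"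
      using av unfolding ball_simps avoids_iff by blast+
    moreover have "a \<noteq> k" "b \<noteq> k"
      using subseq_set_subset[OF ab] assms by auto
    ultimately show "\<not> a < b" by linarith
  qed
next
  assume dec: "sorted_wrt (>) B"
  have "c < b" if "subseq [a, b, c] w" for a b c
  proof -
    have "subseq [b, c] B"
      using that assms(2) by (cases "a = k") (auto dest: subseq_Cons')
    then show ?thesis using dec unfolding sorted_wrt_iff_subseq by fastforce
  qed
  then show "\<forall>p\<in>{[1,2,3], [2,1,3], [3,1,2]}. avoids w p"
    unfolding ball_simps avoids_iff by (meson less_asym less_trans)
qed

lemma Jacobi_Cons_decreasing_iff:
  assumes "w \<in> permutations_of_set {1..n}" "w = k # B" "sorted_wrt (>) B"
  shows "Jacobi w \<longleftrightarrow> even (n - k)"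
proof -
  have dist: "distinct w" and set: "set w = {1..n}"
    using assms(1) by (auto simp: permutations_of_set_def)
  \<comment> \<open>In a decreasing word the letters above \<open>k\<close> come first, so
    \<open>rho\<close> at \<open>k\<close> collects all of them.\<close>
  have "takeWhile (\<lambda>y. k < y) B = filter (\<lambda>y. k < y) B"
    using assms(3) by (induction B) (auto simp: empty_filter_conv)
  then have "rho w k = filter (\<lambda>y. k < y) B"
    using rho_split[of k "[]" B] assms(2) by simp
  moreover have "length (filter (\<lambda>y. k < y) B) = card {y \<in> set B. k < y}"
    using dist assms(2) distinct_length_filter[of B] by (simp add: Int_def conj_commute)
  moreover have "{y \<in> set B. k < y} = {k<..n}"
  proof -
    have B: "set B = {1..n} - {k}" using set dist assms(2) by auto
    show ?thesis unfolding B by auto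
  qed
  ultimately have k: "length (rho w k) = n - k" by simp
  have "rho w x = []" if x: "x \<in> set B" for x
  proof -
    obtain u v where B: "B = u @ x # v" using split_list[OF x] by blast
    have "rho w x = rho ((k # u) @ x # v) x" using B assms(2) by simp
    also have "\<dots> = takeWhile (\<lambda>y. x < y) v"
      by (rule rho_split) (use dist B assms(2) in auto)
    also have "\<dots> = []"
      by (rule takeWhile_greater_eq_Nil)
        (use assms(3) B in \<open>auto simp: sorted_wrt_append\<close>)
    finally show ?thesis .
  qed
  then show ?thesis using k assms(2) unfolding Jacobi_def by auto
qed

text \<open>The words are indexed by \<open>j = n - k\<close> rather than by the first letter
  \<open>k\<close>, so that the index set is the same as for 231.\<close>

lemma Jacobi_avoiding_123_213_312:
  assumes "n \<ge> 1"
  shows "{w \<in> permutations_of_set {1..n}. Jacobi w \<and> (\<forall>p\<in>{[1,2,3], [2,1,3], [3,1,2]}. avoids w p)}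
    = (\<lambda>j. (n - j) # desc ({1..n} - {n - j})) ` {j. j < n \<and> even j}" (is "?L = ?R")
proof
  show "?L \<subseteq> ?R"
  proof
    fix w assume w: "w \<in> ?L"
    then have perm: "w \<in> permutations_of_set {1..n}" by simp
    then have dist: "distinct w" and set: "set w = {1..n}"
      by (auto simp: permutations_of_set_def)
    have "w \<noteq> []" using set assms by auto
    then obtain k B where kB: "w = k # B" by (cases w) auto
    have dec: "sorted_wrt (>) B"
      using w avoids_123_213_312_iff[OF dist kB] by blast
    have even: "even (n - k)"
      using w Jacobi_Cons_decreasing_iff[OF perm kB dec] by blast
    have "set B = {1..n} - {k}" using dist set kB by auto
    then have "B = desc ({1..n} - {k})" using decreasing_eq_desc[OF dec] by metis
    \<comment> \<open>These bounds make the truncated \<open>n - (n - k)\<close> equal to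
      \<open>k\<close> and put \<open>n - k\<close> below \<open>n\<close>.\<close>
    moreover have "1 \<le> k" "k \<le> n" using set kB by auto
    ultimately have "w = (n - (n - k)) # desc ({1..n} - {n - (n - k)})" "n - k < n"
      using kB by auto
    then show "w \<in> ?R" using even by blast
  qed
  show "?R \<subseteq> ?L"
  proof
    fix w assume "w \<in> ?R"
    then obtain j where j: "j < n" "even j"
      and w: "w = (n - j) # desc ({1..n} - {n - j})" by blast
    have "finite ({1..n} - {n - j})" by simp
    note props = desc_props[OF this]
    have dist: "distinct w" using props w by simp
    moreover have "set w = {1..n}"
      unfolding w list.set props(2) using j(1) by auto
    ultimately have perm: "w \<in> permutations_of_set {1..n}"
      by (simp add: permutations_of_set_def)
    have "even (n - (n - j))" using j by simp
    then show "w \<in> ?L"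
      using perm Jacobi_Cons_decreasing_iff[OF perm w props(1)]
        avoids_123_213_312_iff[OF dist w] props(1) by blast
  qed
qed

lemma inj_on_Cons_desc:
  "inj_on (\<lambda>j. (n - j) # desc ({1..n} - {n - j})) {j. j < n \<and> even j}"
  by (rule inj_onI) auto

section \<open>Counting\<close>

lemma card_even_less: "card {j. j < n \<and> even j} = (n + 1) div 2"
proof (induction n)
  case (Suc n)
  \<comment> \<open>The only new candidate is \<open>n\<close>, which enters exactly when it is
    even.\<close>
  have "{j. j < Suc n \<and> even j} = (if even n then insert n else id) {j. j < n \<and> even j}"
    by (auto simp: less_Suc_eq)
  then show ?case using Suc.IH by auto
qed simp

theorem theorem8p8:
  fixes n :: nat and \<sigma> :: "nat list"
  assumes "n \<ge> 1" and "\<sigma> \<in> {[2,3,1], [3,1,2]}"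
  shows "int (num_Jacobi_avoiding n {[1,2,3], [2,1,3], \<sigma>}) = \<lceil>real n / 2\<rceil>"
proof -
  have "num_Jacobi_avoiding n {[1,2,3], [2,1,3], \<sigma>} = card {j. j < n \<and> even j}"
  proof (cases "\<sigma> = [2,3,1]")
    case True
    show ?thesis
      unfolding num_Jacobi_avoiding_def True Jacobi_avoiding_123_213_231[OF assms(1)]
      by (rule card_image[OF inj_on_insert_one])
  next
    case False
    then have \<sigma>: "\<sigma> = [3,1,2]" using assms(2) by simp
    show ?thesis
      unfolding num_Jacobi_avoiding_def \<sigma> Jacobi_avoiding_123_213_312[OF assms(1)]
      by (rule card_image[OF inj_on_Cons_desc])
  qed
  also have "int \<dots> = \<lceil>real n / 2\<rceil>"
    \<comment> \<open>The ceiling is the only integer \<open>m\<close> with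
      \<open>m - 1 < n / 2 \<le> m\<close>, and \<open>(n + 1) div 2\<close> satisfies both
      bounds.\<close>
    unfolding card_even_less by (rule ceiling_unique[symmetric]) linarith+
  finally show ?thesis .
qed

end
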